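(* For every destination $d\in\mathcal{D}$, Algorithm A (described in full in the context) constructs a decision diagram $\mathsf{D}^d$ with $O(n_d\cdot v^{\mathrm{cap}})$ nodes and $O(n_d\cdot v^{\mathrm{cap}}\cdot T_w)$ arcs that satisfies the following properties (DD-1), (DD-2) and (DD-3), and that can be constructed in time $O(n\cdot v^{\mathrm{cap}}\cdot T_w)$. Here $\mathcal{P}^d$ denotes the set of root-to-terminal paths of $\mathsf{D}^d$. (DD-1) For every $p\in\mathcal{P}^d$ and every $j\in\mathcal{J}(d)$ there is exactly one group $g\in\mathsf{g}(p)$ with $j\in g$. (DD-2) For every $p\in\mathcal{P}^d$, every $j\in\mathcal{J}(d)$ and the group $g\in\mathsf{g}(p)$ with $j\in g$, if $a^p(g)$ denotes the one-arc of $p$ selecting $g$, then $t^r(j)-T_w\le t^0(a^p(g))+\tau^1(d)\le t^r(j)+T_w$. (DD-3) For every partition $\mathsf{g}\in\mathcal{G}^d$ there is a path $p\in\mathcal{P}^d$ with $\mathsf{g}(p)=\mathsf{g}$, and this for every time at which the passengers in the groups can depart together; that is, for every choice, for each group of $\mathsf{g}$, of a time at which its passengers can depart together, there is such a path $p$ whose one-arcs have these times as arc-start-times.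
   Context: Setting. All times are integers. There is a terminal $\mathbf{T}_0$ and a finite set $\mathcal{C}$ of mass transit trips. Trip $c$ leaves station $s$ at time $\tilde t(c,s)$ and arrives at $\mathbf{T}_0$ at time $\tilde t(c)$; each trip stops at every station. $\mathcal{D}$ is the set of destinations. A commuter vehicle (CV) leaving $\mathbf{T}_0$ at time $t$ for $d\in\mathcal{D}$ arrives there at time $t+\tau^1(d)$. A CV trip carries at most $v^{\mathrm{cap}}$ passengers, all with the same destination. $\mathcal{J}$ is the set of passengers and $n=|\mathcal{J}|$. Passenger $j$ has origin station $s(j)$, a destination, and a requested arrival time $t^r(j)$, and must arrive at the destination between $t^r(j)-T_w$ and $t^r(j)+T_w$. $\mathcal{J}(d)=\{j^d_1,\dots,j^d_{n_d}\}$ is the set of passengers with destination $d$, indexed in nondecreasing order of $t^r$, and $n_d=|\mathcal{J}(d)|$. $\alpha\in[0,1]$ is a fixed weight. Departure times. The earliest and latest possible departure times of passenger $j\in\mathcal{J}(d)$ from $\mathbf{T}_0$ are $$t^e(j)=\max\{t^r(j)-T_w-\tau^1(d),\ \min_{c\in\mathcal{C}}\tilde t(c)\},\qquad t^l(j)=\min\{t^r(j)+T_w-\tau^1(d),\ \max_{c\in\mathcal{C}}\tilde t(c)\}.$$ The passengers of a nonempty group $g\subseteq\mathcal{J}(d)$ can depart together at time $t$ if $\max_{j\in g}t^e(j)\le t\le\min_{j\in g}t^l(j)$. They can board a common CV if $|g|\le v^{\mathrm{cap}}$ and they can depart together at some time. $\mathcal{G}^d$ is the set of all partitions of $\mathcal{J}(d)$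 into sets of contiguously indexed passengers, each of which can board a common CV. Decision diagram. $\mathsf{D}^d$ is a layered acyclic directed multigraph with ordered layers $L^d_1,\dots,L^d_{n_d+1}$, where $L^d_1=\{\mathbf{r}^d\}$ (root) and $L^d_{n_d+1}=\{\mathbf{t}^d\}$ (terminal). Each arc $a$ goes from a node $\psi(a)$ in some layer $i$ to a node $\omega(a)$ in layer $i+1$, and its arc-layer is $\ell(a)=i$. It is assumed that every maximal directed path connects $\mathbf{r}^d$ to $\mathbf{t}^d$. Each node $u$ has a state $\mathsf{s}(u)\in\{0,\dots,v^{\mathrm{cap}}-1\}$. Each arc is either a one-arc or a zero-arc. A one-arc $a$ corresponds to the group $$g(a)=\{j^d_{\ell(a)-\mathsf{s}(\psi(a))},\,j^d_{\ell(a)-\mathsf{s}(\psi(a))+1},\dots,j^d_{\ell(a)}\}$$ and stores an arc-start-time $t^0(a)$ (the time at which $g(a)$ departs from $\mathbf{T}_0$) and an arc-cost $\eta(a)$. A zero-arc means that the passenger of that layer shares the CV with the next passenger. For a root-to-terminal path $p$, $\mathsf{g}(p)=\{g(a): a\text{ is a one-arc of }p\}$. Algorithm A (for destination $d$, passengers $j^d_1,\dots,j^d_{n_d}$). The node with state $k$ in layer $i$ is denoted $u_i^k$. 1. Compute $t^e(j^d_i)$ and $t^l(j^d_i)$ for all $i$. 2. Add node $u_1^0$ (the root $\mathbf{r}^d$) to $L^d_1$. 3. For $i=1,\dots,n_d$: (a) Add node $u_{i+1}^0$ (state $0$) to $L^d_{i+1}$; for $i=n_d$ this is the terminal $\mathbf{t}^d$.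 (b) For $k=0,\dots,|L^d_i|-1$: - If $k<v^{\mathrm{cap}}-1$, $i<n_d$ and $t^e(j^d_{i+1})\le t^l(j^d_{i-k})$, add node $u_{i+1}^{k+1}$ (state $k+1$) to $L^d_{i+1}$ and a zero-arc from $u_i^k$ to $u_{i+1}^{k+1}$ with cost $0$. - For each $t=t^e(j^d_i),t^e(j^d_i)+1,\dots,t^l(j^d_{i-k})$, add a one-arc $a$ from $u_i^k$ to $u_{i+1}^0$ with $t^0(a)=t$ and $$\eta(a)=\alpha\sum_{j\in g(a)}\Bigl(t+\tau^1(d)-\max_{c\in\mathcal{C}:\,\tilde t(c)\le t}\tilde t(c,s(j))\Bigr)+(1-\alpha).$$ Running time convention: creating an arc, with its attributes, counts as constant time.
   Formalization: That every maximal path connects root to terminal is claimed only when t^e(j) ≤ t^l(j) for every passenger j of J(d) (otherwise Algorithm A makes a dead-end node); the O-bounds are stated for n_d ≥ 1 and T_w ≥ 1 (at n_d = 0 or T_w = 0 a claimed bound is 0). *)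

theory Defs
  imports
    Complex_Main
    "HOL-Library.Landau_Symbols"
    "HOL-Library.Disjoint_Sets"
    "Graph_Theory.Arc_Walk"
begin

section \<open>Problem instances\<close>

record ('c, 's, 'd, 'p) transit_instance =
  trips :: "'c set"
  dep_time :: "'c \<Rightarrow> 's \<Rightarrow> int"
  arr_time :: "'c \<Rightarrow> int"
  destinations :: "'d set"
  travel_time :: "'d \<Rightarrow> int"
  v_cap :: nat
  passengers :: "'p set"
  origin :: "'p \<Rightarrow> 's"
  dest :: "'p \<Rightarrow> 'd"
  t_req :: "'p \<Rightarrow> int"
  T_w :: int
  weight :: real
  passenger_at :: "'d \<Rightarrow> nat \<Rightarrow> 'p"

text \<open>\<^term>\<open>travel_time I\<close> is \<open>\<tau>\<^sup>1\<close>, \<^term>\<open>dep_time I c s\<close> and \<^term>\<open>arr_time I c\<close> are the times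
  at which trip \<open>c\<close> leaves station \<open>s\<close> and reaches the terminal, and \<^term>\<open>weight I\<close> is \<open>\<alpha>\<close>.
  \<^term>\<open>passenger_at I d i\<close> is the passenger \<open>j\<^sup>d\<^sub>i\<close>; indices run from 1.\<close>

definition passengers_to :: "('c, 's, 'd, 'p) transit_instance \<Rightarrow> 'd \<Rightarrow> 'p set" where
  "passengers_to I d = {j \<in> passengers I. dest I j = d}"

definition n_to :: "('c, 's, 'd, 'p) transit_instance \<Rightarrow> 'd \<Rightarrow> nat" where
  "n_to I d = card (passengers_to I d)"

definition valid_instance :: "('c, 's, 'd, 'p) transit_instance \<Rightarrow> bool" where
  "valid_instance I \<longleftrightarrow>
     finite (trips I) \<and> trips I \<noteq> {} \<and>
     finite (passengers I) \<and> dest I ` passengers I \<subseteq> destinations I \<and>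
     1 \<le> v_cap I \<and> 0 \<le> weight I \<and> weight I \<le> 1 \<and>
     (\<forall>d \<in> destinations I.
        bij_betw (passenger_at I d) {1..n_to I d} (passengers_to I d) \<and>
        mono_on {1..n_to I d} (\<lambda>i. t_req I (passenger_at I d i)))"

definition earliest_dep :: "('c, 's, 'd, 'p) transit_instance \<Rightarrow> 'p \<Rightarrow> int" where
  "earliest_dep I j =
     max (t_req I j - T_w I - travel_time I (dest I j)) (Min (arr_time I ` trips I))"

definition latest_dep :: "('c, 's, 'd, 'p) transit_instance \<Rightarrow> 'p \<Rightarrow> int" where
  "latest_dep I j =
     min (t_req I j + T_w I - travel_time I (dest I j)) (Max (arr_time I ` trips I))"

definition can_depart_at :: "('c, 's, 'd, 'p) transit_instance \<Rightarrow> 'p set \<Rightarrow> int \<Rightarrow> bool" where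
  "can_depart_at I g t \<longleftrightarrow>
     g \<noteq> {} \<and> Max (earliest_dep I ` g) \<le> t \<and> t \<le> Min (latest_dep I ` g)"

definition can_board :: "('c, 's, 'd, 'p) transit_instance \<Rightarrow> 'p set \<Rightarrow> bool" where
  "can_board I g \<longleftrightarrow> card g \<le> v_cap I \<and> (\<exists>t. can_depart_at I g t)"

definition contiguous :: "('c, 's, 'd, 'p) transit_instance \<Rightarrow> 'd \<Rightarrow> 'p set \<Rightarrow> bool" where
  "contiguous I d g \<longleftrightarrow>
     (\<exists>a b. 1 \<le> a \<and> a \<le> b \<and> b \<le> n_to I d \<and> g = passenger_at I d ` {a..b})"

definition group_partitions ::
    "('c, 's, 'd, 'p) transit_instance \<Rightarrow> 'd \<Rightarrow> 'p set set set" where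
  "group_partitions I d =
     {P. partition_on (passengers_to I d) P \<and> (\<forall>g \<in> P. contiguous I d g \<and> can_board I g)}"

text \<open>The group \<open>{j\<^sup>d\<^bsub>i-k\<^esub>, \<dots>, j\<^sup>d\<^sub>i}\<close> of a one-arc leaving a node with state \<open>k\<close> in
  layer \<open>i\<close>.\<close>

definition group_at :: "('c, 's, 'd, 'p) transit_instance \<Rightarrow> 'd \<Rightarrow> nat \<Rightarrow> nat \<Rightarrow> 'p set" where
  "group_at I d i k = passenger_at I d ` {i - k..i}"


section \<open>Decision diagrams\<close>

record ('u, 'a) decision_diagram =
  dgraph :: "('u, 'a) pre_digraph"
  layer_of :: "'u \<Rightarrow> nat"
  node_state :: "'u \<Rightarrow> nat"
  dd_root :: 'u
  dd_terminal :: 'u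
  one_arcs :: "'a set"
  start_time :: "'a \<Rightarrow> int"
  arc_cost :: "'a \<Rightarrow> real"

text \<open>The arcs outside \<^term>\<open>one_arcs D\<close> are the zero-arcs; \<^term>\<open>start_time D\<close> carries no
  meaning on them.\<close>

definition layer :: "('u, 'a) decision_diagram \<Rightarrow> nat \<Rightarrow> 'u set" where
  "layer D i = {u \<in> verts (dgraph D). layer_of D u = i}"

definition arc_layer :: "('u, 'a) decision_diagram \<Rightarrow> 'a \<Rightarrow> nat" where
  "arc_layer D a = layer_of D (tail (dgraph D) a)"

text \<open>The arguments \<open>v\<close> and \<open>n\<close> are the capacity and the number of arc-layers. The last condition
  says that the indices in the group of a one-arc are at least 1, so that the subtraction in
  \<^const>\<open>group_at\<close> does not truncate.\<close>

definition layered_diagram :: "nat \<Rightarrow> nat \<Rightarrow> ('u, 'a) decision_diagram \<Rightarrow> bool" where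
  "layered_diagram v n D \<longleftrightarrow>
     fin_digraph (dgraph D) \<and>
     layer_of D ` verts (dgraph D) \<subseteq> {1..n + 1} \<and>
     layer D 1 = {dd_root D} \<and> layer D (n + 1) = {dd_terminal D} \<and>
     (\<forall>a \<in> arcs (dgraph D). layer_of D (head (dgraph D) a) = arc_layer D a + 1) \<and>
     (\<forall>u \<in> verts (dgraph D). node_state D u < v) \<and>
     one_arcs D \<subseteq> arcs (dgraph D) \<and>
     (\<forall>a \<in> one_arcs D. node_state D (tail (dgraph D) a) < arc_layer D a)"

text \<open>Layered diagrams are acyclic, so a directed path is maximal iff it can be extended
  neither at its start nor at its end.\<close>

definition maximal_path :: "('u, 'a) decision_diagram \<Rightarrow> 'u \<Rightarrow> 'a list \<Rightarrow> 'u \<Rightarrow> bool" where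
  "maximal_path D u p w \<longleftrightarrow>
     pre_digraph.awalk (dgraph D) u p w \<and>
     (\<forall>a \<in> arcs (dgraph D). head (dgraph D) a \<noteq> u \<and> tail (dgraph D) a \<noteq> w)"

definition is_decision_diagram :: "nat \<Rightarrow> nat \<Rightarrow> ('u, 'a) decision_diagram \<Rightarrow> bool" where
  "is_decision_diagram v n D \<longleftrightarrow>
     layered_diagram v n D \<and>
     (\<forall>u p w. maximal_path D u p w \<longrightarrow> u = dd_root D \<and> w = dd_terminal D)"

definition root_terminal_paths :: "('u, 'a) decision_diagram \<Rightarrow> 'a list set" where
  "root_terminal_paths D = {p. pre_digraph.awalk (dgraph D) (dd_root D) p (dd_terminal D)}"

definition arc_group ::
    "('c, 's, 'd, 'p) transit_instance \<Rightarrow> 'd \<Rightarrow> ('u, 'a) decision_diagram \<Rightarrow> 'a \<Rightarrow> 'p set" where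
  "arc_group I d D a = group_at I d (arc_layer D a) (node_state D (tail (dgraph D) a))"

definition path_one_arcs :: "('u, 'a) decision_diagram \<Rightarrow> 'a list \<Rightarrow> 'a set" where
  "path_one_arcs D p = set p \<inter> one_arcs D"

definition path_groups ::
    "('c, 's, 'd, 'p) transit_instance \<Rightarrow> 'd \<Rightarrow> ('u, 'a) decision_diagram \<Rightarrow> 'a list \<Rightarrow> 'p set set"
where
  "path_groups I d D p = arc_group I d D ` path_one_arcs D p"

definition DD1 ::
    "('c, 's, 'd, 'p) transit_instance \<Rightarrow> 'd \<Rightarrow> ('u, 'a) decision_diagram \<Rightarrow> bool" where
  "DD1 I d D \<longleftrightarrow>
     (\<forall>p \<in> root_terminal_paths D. \<forall>j \<in> passengers_to I d. \<exists>!g. g \<in> path_groups I d D p \<and> j \<in> g)"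

definition DD2 ::
    "('c, 's, 'd, 'p) transit_instance \<Rightarrow> 'd \<Rightarrow> ('u, 'a) decision_diagram \<Rightarrow> bool" where
  "DD2 I d D \<longleftrightarrow>
     (\<forall>p \<in> root_terminal_paths D. \<forall>j \<in> passengers_to I d. \<forall>g \<in> path_groups I d D p. j \<in> g \<longrightarrow>
        (\<exists>!a. a \<in> path_one_arcs D p \<and> arc_group I d D a = g) \<and>
        (\<forall>a \<in> path_one_arcs D p. arc_group I d D a = g \<longrightarrow>
           t_req I j - T_w I \<le> start_time D a + travel_time I d \<and>
           start_time D a + travel_time I d \<le> t_req I j + T_w I))"

definition DD3 ::
    "('c, 's, 'd, 'p) transit_instance \<Rightarrow> 'd \<Rightarrow> ('u, 'a) decision_diagram \<Rightarrow> bool" where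
  "DD3 I d D \<longleftrightarrow>
     (\<forall>P \<in> group_partitions I d. \<forall>\<theta>. (\<forall>g \<in> P. can_depart_at I g (\<theta> g)) \<longrightarrow>
        (\<exists>p \<in> root_terminal_paths D. path_groups I d D p = P \<and>
           (\<forall>a \<in> path_one_arcs D p. start_time D a = \<theta> (arc_group I d D a))))"


section \<open>The construction algorithm\<close>

text \<open>The node \<open>u\<^sub>i\<^sup>k\<close> is the pair \<open>(i, k)\<close>.\<close>

type_synonym node = "nat \<times> nat"

datatype dd_arc =
    Zero_Arc (source: node) (target: node) (cost: real)
  | is_one_arc: One_Arc (source: node) (target: node) (cost: real) (dep_at: int)

text \<open>The algorithm is an imperative program on the following state, which contains the tables of
  the values \<open>t\<^sup>e(j\<^sup>d\<^sub>i)\<close> and \<open>t\<^sup>l(j\<^sup>d\<^sub>i)\<close> and the number of elementary steps executed so far.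
  One step is charged for each of the following: computing an entry of a table, creating a node,
  creating an arc with its attributes, evaluating the condition of an \<open>if\<close>, and each test of the
  loop condition (including the final one that leaves the loop). The extremal arrival times
  \<open>min\<^sub>c t(c)\<close> and \<open>max\<^sub>c t(c)\<close> count as input data.\<close>

record build_state =
  te_tab :: "nat \<Rightarrow> int"
  tl_tab :: "nat \<Rightarrow> int"
  built_nodes :: "node set"
  built_arcs :: "dd_arc set"
  steps :: nat

definition tick :: "build_state \<Rightarrow> build_state" where
  "tick \<sigma> = \<sigma>\<lparr>steps := steps \<sigma> + 1\<rparr>"

definition for_each :: "'x list \<Rightarrow> ('x \<Rightarrow> build_state \<Rightarrow> build_state) \<Rightarrow> build_state \<Rightarrow> build_state"
where
  "for_each xs body \<sigma> = tick (fold (\<lambda>x \<sigma>. body x (tick \<sigma>)) xs \<sigma>)"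

definition set_te :: "nat \<Rightarrow> int \<Rightarrow> build_state \<Rightarrow> build_state" where
  "set_te i t \<sigma> = tick (\<sigma>\<lparr>te_tab := (te_tab \<sigma>)(i := t)\<rparr>)"

definition set_tl :: "nat \<Rightarrow> int \<Rightarrow> build_state \<Rightarrow> build_state" where
  "set_tl i t \<sigma> = tick (\<sigma>\<lparr>tl_tab := (tl_tab \<sigma>)(i := t)\<rparr>)"

definition add_node :: "node \<Rightarrow> build_state \<Rightarrow> build_state" where
  "add_node u \<sigma> = tick (\<sigma>\<lparr>built_nodes := insert u (built_nodes \<sigma>)\<rparr>)"

definition add_arc :: "dd_arc \<Rightarrow> build_state \<Rightarrow> build_state" where
  "add_arc a \<sigma> = tick (\<sigma>\<lparr>built_arcs := insert a (built_arcs \<sigma>)\<rparr>)"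

definition layer_size :: "build_state \<Rightarrow> nat \<Rightarrow> nat" where
  "layer_size \<sigma> i = card {u \<in> built_nodes \<sigma>. fst u = i}"

definition one_arc_cost ::
    "('c, 's, 'd, 'p) transit_instance \<Rightarrow> 'd \<Rightarrow> nat \<Rightarrow> nat \<Rightarrow> int \<Rightarrow> real" where
  "one_arc_cost I d i k t =
     weight I * (\<Sum>j \<in> group_at I d i k.
       real_of_int (t + travel_time I d -
         Max ((\<lambda>c. dep_time I c (origin I j)) ` {c \<in> trips I. arr_time I c \<le> t})))
     + (1 - weight I)"

definition compute_times ::
    "('c, 's, 'd, 'p) transit_instance \<Rightarrow> 'd \<Rightarrow> nat \<Rightarrow> build_state \<Rightarrow> build_state" where
  "compute_times I d i \<sigma> =
     set_tl i (latest_dep I (passenger_at I d i))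
       (set_te i (earliest_dep I (passenger_at I d i)) \<sigma>)"

definition extend_group ::
    "('c, 's, 'd, 'p) transit_instance \<Rightarrow> 'd \<Rightarrow> nat \<Rightarrow> nat \<Rightarrow> build_state \<Rightarrow> build_state" where
  "extend_group I d i k \<sigma> =
     (if k < v_cap I - 1 \<and> i < n_to I d \<and> te_tab \<sigma> (i + 1) \<le> tl_tab \<sigma> (i - k)
      then add_arc (Zero_Arc (i, k) (i + 1, k + 1) 0) (add_node (i + 1, k + 1) (tick \<sigma>))
      else tick \<sigma>)"

definition close_group ::
    "('c, 's, 'd, 'p) transit_instance \<Rightarrow> 'd \<Rightarrow> nat \<Rightarrow> nat \<Rightarrow> build_state \<Rightarrow> build_state" where
  "close_group I d i k \<sigma> =
     for_each [te_tab \<sigma> i..tl_tab \<sigma> (i - k)]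
       (\<lambda>t. add_arc (One_Arc (i, k) (i + 1, 0) (one_arc_cost I d i k t) t)) \<sigma>"

definition process_layer ::
    "('c, 's, 'd, 'p) transit_instance \<Rightarrow> 'd \<Rightarrow> nat \<Rightarrow> build_state \<Rightarrow> build_state" where
  "process_layer I d i \<sigma> =
     for_each [0..<layer_size \<sigma> i]
       (\<lambda>k. close_group I d i k \<circ> extend_group I d i k)
       (add_node (i + 1, 0) \<sigma>)"

definition initial_state :: build_state where
  "initial_state =
     \<lparr>te_tab = (\<lambda>_. 0), tl_tab = (\<lambda>_. 0), built_nodes = {}, built_arcs = {}, steps = 0\<rparr>"

definition algorithm_A ::
    "('c, 's, 'd, 'p) transit_instance \<Rightarrow> 'd \<Rightarrow> build_state" where
  "algorithm_A I d =
     for_each [1..<n_to I d + 1] (process_layer I d)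
       (add_node (1, 0)
         (for_each [1..<n_to I d + 1] (compute_times I d) initial_state))"

definition constructed_diagram ::
    "('c, 's, 'd, 'p) transit_instance \<Rightarrow> 'd \<Rightarrow> (node, dd_arc) decision_diagram" where
  "constructed_diagram I d =
     \<lparr>dgraph =
        \<lparr>verts = built_nodes (algorithm_A I d), arcs = built_arcs (algorithm_A I d),
         tail = source, head = target\<rparr>,
      layer_of = fst,
      node_state = snd,
      dd_root = (1, 0),
      dd_terminal = (n_to I d + 1, 0),
      one_arcs = {a \<in> built_arcs (algorithm_A I d). is_one_arc a},
      start_time = dep_at,
      arc_cost = cost\<rparr>"

definition running_time :: "('c, 's, 'd, 'p) transit_instance \<Rightarrow> 'd \<Rightarrow> nat" where
  "running_time I d = steps (algorithm_A I d)"

text \<open>The domain of the asymptotic estimates: the parameters \<open>n\<^sub>d\<close>, \<open>v\<^sup>c\<^sup>a\<^sup>p\<close> and \<open>T\<^sub>w\<close> are positive.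
  Over the principal filter of this set, \<open>f \<in> O(g)\<close> means that a single constant \<open>c\<close> satisfies
  \<open>\<bar>f\<bar> \<le> c * \<bar>g\<bar>\<close> for all these instances and destinations.\<close>

definition asymptotic_domain :: "(('c, 's, 'd, 'p) transit_instance \<times> 'd) set" where
  "asymptotic_domain =
     {(I, d). valid_instance I \<and> d \<in> destinations I \<and> 1 \<le> n_to I d \<and> 1 \<le> T_w I}"

end

theory Submission
  imports Defs
begin

text \<open>
  Because the passengers are sorted by requested arrival time, \<open>t\<^sup>e\<close> and \<open>t\<^sup>l\<close> are nondecreasing
  in the index, so a contiguous group can depart together at \<open>t\<close> iff \<open>t\<close> lies between \<open>t\<^sup>e\<close> of its
  last and \<open>t\<^sup>l\<close> of its first member. Hence the states that occur in layer \<open>i\<close> form an initial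
  segment of the naturals, and \<open>u\<^sub>i\<^sup>k\<close> with \<open>k > 0\<close> exists iff \<open>j\<^bsub>i-k\<^esub>, \<dots>, j\<^sub>i\<close> can board a common
  vehicle. Along a path the node \<open>u\<^sub>i\<^sup>k\<close> means that exactly the passengers before \<open>j\<^bsub>i-k\<^esub>\<close> have been
  assigned to groups; a zero-arc preserves \<open>i - k\<close> and a one-arc assigns \<open>j\<^bsub>i-k\<^esub>, \<dots>, j\<^sub>i\<close>. Conversely,
  a partition into contiguous groups dictates the arc to take in each layer. For the bounds, a node
  has at most \<open>2 T\<^sub>w + 1\<close> outgoing one-arcs.
\<close>

section \<open>Effect of program fragments\<close>

text \<open>Besides the bound on the steps we record that every new arc has been paid for by a step, so
  that the running time also bounds the number of arcs.\<close>

definition grows ::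
    "node set \<Rightarrow> dd_arc set \<Rightarrow> nat \<Rightarrow> build_state \<Rightarrow> build_state \<Rightarrow> bool" where
  "grows V A c \<sigma> \<sigma>' \<longleftrightarrow>
     te_tab \<sigma>' = te_tab \<sigma> \<and> tl_tab \<sigma>' = tl_tab \<sigma> \<and>
     built_nodes \<sigma>' = built_nodes \<sigma> \<union> V \<and> built_arcs \<sigma>' = built_arcs \<sigma> \<union> A \<and>
     steps \<sigma>' \<le> steps \<sigma> + c \<and>
     card (built_arcs \<sigma>') + steps \<sigma> \<le> card (built_arcs \<sigma>) + steps \<sigma>'"

lemma grows_refl: "grows {} {} 0 \<sigma> \<sigma>"
  by (simp add: grows_def)

lemma grows_trans:
  assumes "grows V A c \<sigma> \<sigma>'" "grows V' A' c' \<sigma>' \<sigma>''"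
  shows "grows (V \<union> V') (A \<union> A') (c + c') \<sigma> \<sigma>''"
  using assms by (auto simp: grows_def)

lemma grows_mono:
  assumes "grows V A c \<sigma> \<sigma>'" "c \<le> c'"
  shows "grows V A c' \<sigma> \<sigma>'"
  using assms by (auto simp: grows_def)

lemma grows_tick: "grows {} {} 1 \<sigma> (tick \<sigma>)"
  by (simp add: grows_def tick_def)

lemma grows_add_node: "grows {u} {} 1 \<sigma> (add_node u \<sigma>)"
  by (simp add: grows_def add_node_def tick_def)

lemma grows_add_arc: "grows {} {a} 1 \<sigma> (add_arc a \<sigma>)"
proof -
  have "card (insert a (built_arcs \<sigma>)) \<le> Suc (card (built_arcs \<sigma>))"
    \<comment> \<open>Inserting an arc that is already present does not change the cardinality; for
      an infinite set \<open>card\<close> is 0 before and after.\<close>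
    by (cases "finite (built_arcs \<sigma>)") (auto simp: card_insert_if)
  then show ?thesis
    by (simp add: grows_def add_arc_def tick_def)
qed

text \<open>The body may assume what the earlier iterations have done, so invariants such as the
  contents of the current layer can be derived inside the loop. An iteration pays \<open>c\<close>
  and one loop test. The final \<open>+ 1\<close> is the exit test; in the assumption on the body it
  is the test already passed by the current iteration.\<close>

lemma grows_for_each:
  assumes body: "\<And>ys x zs \<sigma>'. xs = ys @ x # zs \<Longrightarrow>
      grows (\<Union>x\<in>set ys. V x) (\<Union>x\<in>set ys. A x) (length ys * (c + 1) + 1) \<sigma> \<sigma>' \<Longrightarrow>
      grows (V x) (A x) c \<sigma>' (body x \<sigma>')"
  shows "grows (\<Union>x\<in>set xs. V x) (\<Union>x\<in>set xs. A x) (length xs * (c + 1) + 1)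
           \<sigma> (for_each xs body \<sigma>)"
proof -
  have "grows (\<Union>x\<in>set ys. V x) (\<Union>x\<in>set ys. A x) (length ys * (c + 1))
          \<sigma> (fold (\<lambda>x \<sigma>. body x (tick \<sigma>)) ys \<sigma>)" if "xs = ys @ zs" for ys zs
    using that
  proof (induction ys arbitrary: zs rule: rev_induct)
    case Nil
    then show ?case by (simp add: grows_refl)
  next
    case (snoc x ys)
    let ?\<sigma> = "fold (\<lambda>x \<sigma>. body x (tick \<sigma>)) ys \<sigma>"
    have xs: "xs = ys @ x # zs" using snoc.prems by simp
    have 1: "grows (\<Union>x\<in>set ys. V x) (\<Union>x\<in>set ys. A x) (length ys * (c + 1) + 1) \<sigma> (tick ?\<sigma>)"
      using grows_trans[OF snoc.IH[OF xs] grows_tick] by simp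
    from grows_trans[OF 1 body[OF xs 1]] show ?case
      by (simp add: Un_commute algebra_simps)
  qed
  from grows_trans[OF this[of xs "[]"] grows_tick] show ?thesis
    by (simp add: for_each_def)
qed


section \<open>The constructed diagram\<close>

locale transit_destination =
  fixes I :: "('c, 's, 'd, 'p) transit_instance" and d :: 'd
  assumes valid: "valid_instance I" and destination: "d \<in> destinations I"
begin

section \<open>Indexed passengers and their departure windows\<close>

abbreviation n where "n \<equiv> n_to I d"
abbreviation v where "v \<equiv> v_cap I"
abbreviation J where "J \<equiv> passenger_at I d"

definition t_e :: "nat \<Rightarrow> int" where "t_e i = earliest_dep I (J i)"
definition t_l :: "nat \<Rightarrow> int" where "t_l i = latest_dep I (J i)"

lemma v_pos: "1 \<le> v"
  using valid by (simp add: valid_instance_def)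

lemma J_bij: "bij_betw J {1..n} (passengers_to I d)"
  using valid destination by (simp add: valid_instance_def)

lemma J_inj: "inj_on J {1..n}"
  using J_bij by (rule bij_betw_imp_inj_on)

lemma J_image: "J ` {1..n} = passengers_to I d"
  using J_bij by (rule bij_betw_imp_surj_on)

lemma J_mem: "1 \<le> i \<Longrightarrow> i \<le> n \<Longrightarrow> J i \<in> passengers_to I d"
  using J_image by auto

lemma J_E:
  assumes "j \<in> passengers_to I d"
  obtains m where "m \<in> {1..n}" "j = J m"
  using assms unfolding J_image[symmetric] by blast

lemma dest_J: "1 \<le> i \<Longrightarrow> i \<le> n \<Longrightarrow> dest I (J i) = d"
  using J_mem by (simp add: passengers_to_def)

lemma t_req_mono: "1 \<le> i \<Longrightarrow> i \<le> j \<Longrightarrow> j \<le> n \<Longrightarrow> t_req I (J i) \<le> t_req I (J j)"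
  using valid destination by (auto simp: valid_instance_def mono_on_def)

lemma t_e_mono: "1 \<le> i \<Longrightarrow> i \<le> j \<Longrightarrow> j \<le> n \<Longrightarrow> t_e i \<le> t_e j"
  using t_req_mono[of i j] by (auto simp: t_e_def earliest_dep_def dest_J)

lemma t_l_mono: "1 \<le> i \<Longrightarrow> i \<le> j \<Longrightarrow> j \<le> n \<Longrightarrow> t_l i \<le> t_l j"
  using t_req_mono[of i j] by (auto simp: t_l_def latest_dep_def dest_J)

lemma t_e_ge: "1 \<le> i \<Longrightarrow> i \<le> n \<Longrightarrow> t_req I (J i) - T_w I - travel_time I d \<le> t_e i"
  by (simp add: t_e_def earliest_dep_def dest_J)

lemma t_l_le: "1 \<le> i \<Longrightarrow> i \<le> n \<Longrightarrow> t_l i \<le> t_req I (J i) + T_w I - travel_time I d"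
  by (simp add: t_l_def latest_dep_def dest_J)

text \<open>Since \<open>t\<^sup>e\<close> is monotone, the tests made along the zero-arcs that lead to \<open>u\<^sub>i\<^sup>k\<close> reduce to the
  last one.\<close>

definition is_node :: "nat \<Rightarrow> nat \<Rightarrow> bool" where
  "is_node i k \<longleftrightarrow> 1 \<le> i \<and> i \<le> n + 1 \<and>
     (k = 0 \<or> k < v \<and> k < i \<and> i \<le> n \<and> t_e i \<le> t_l (i - k))"

lemma is_nodeD: "is_node i k \<Longrightarrow> 1 \<le> i \<and> i \<le> n + 1 \<and> k < v \<and> k < i"
  using v_pos by (auto simp: is_node_def)

text \<open>A zero-arc keeps the first waiting passenger \<open>i - k\<close> fixed, and
  \<open>t_e\<close> cannot increase when going back one layer. Hence zero-arcs into existing nodes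
  have existing tails.\<close>

lemma is_node_pred:
  assumes "is_node (Suc i) (Suc k)"
  shows "is_node i k"
proof -
  have "t_e i \<le> t_e (Suc i)" if "i \<ge> 1" "i \<le> n" using that assms
    by (intro t_e_mono) (auto simp: is_node_def)
  then show ?thesis using assms by (auto simp: is_node_def)
qed

text \<open>With fewer waiting passengers the first one has a larger index, and its
  \<open>t_l\<close> is at least as large.\<close>

lemma is_node_down:
  assumes "is_node i k" "k' \<le> k"
  shows "is_node i k'"
proof -
  have "t_l (i - k) \<le> t_l (i - k')" if "0 < k'"
    using assms that by (intro t_l_mono) (auto simp: is_node_def)
  then show ?thesis using assms by (force simp: is_node_def)
qed

text \<open>The inner loop counts \<open>k\<close> from 0 up to the size of the layer, so the states
  must be exactly these numbers. They are, because a finite downward closed set of naturals is an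
  initial segment.\<close>

lemma is_node_states: "{k. is_node i k} = {..<card {k. is_node i k}}"
proof (intro set_eqI iffI)
  let ?K = "{k. is_node i k}"
  have fin: "finite ?K" by (rule finite_subset[of _ "{..<v}"]) (auto dest: is_nodeD)
  {
    fix k assume "k \<in> ?K"
    then have "{..k} \<subseteq> ?K" using is_node_down by blast
    then have "card {..k} \<le> card ?K" by (rule card_mono[OF fin])
    then show "k \<in> {..<card ?K}" by simp
  next
    fix k assume k: "k \<in> {..<card ?K}"
    show "k \<in> ?K"
    proof (rule ccontr)
      assume *: "k \<notin> ?K"
      have "?K \<subseteq> {..<k}"
      proof
        fix m assume "m \<in> ?K"
        with * show "m \<in> {..<k}" using is_node_down[of i m k] by (cases "m < k") auto
      qed
      then have "card ?K \<le> card {..<k}" by (intro card_mono) auto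
      with k show False by simp
    qed
  }
qed

section \<open>Layers and outgoing arcs as explicit sets\<close>

definition node_layer :: "nat \<Rightarrow> node set" where
  "node_layer i = Pair i ` {k. is_node i k}"

definition zero_arc :: "nat \<Rightarrow> nat \<Rightarrow> dd_arc" where
  "zero_arc i k = Zero_Arc (i, k) (i + 1, k + 1) 0"

definition one_arc :: "nat \<Rightarrow> nat \<Rightarrow> int \<Rightarrow> dd_arc" where
  "one_arc i k t = One_Arc (i, k) (i + 1, 0) (one_arc_cost I d i k t) t"

definition arcs_from :: "nat \<Rightarrow> nat \<Rightarrow> dd_arc set" where
  "arcs_from i k =
     (if is_node (i + 1) (k + 1) then {zero_arc i k} else {}) \<union> one_arc i k ` {t_e i..t_l (i - k)}"

section \<open>Effect and cost of the loops\<close>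

definition tables :: "build_state \<Rightarrow> bool" where
  "tables \<sigma> \<longleftrightarrow> (\<forall>i\<in>{1..n}. te_tab \<sigma> i = t_e i \<and> tl_tab \<sigma> i = t_l i)"

lemma tables_grows: "grows V A c \<sigma> \<sigma>' \<Longrightarrow> tables \<sigma>' = tables \<sigma>"
  by (simp add: grows_def tables_def)

text \<open>The number of integers in a closed window of length \<open>2 * T_w I\<close>, which
  bounds the number of one-arcs leaving a node.\<close>

definition width :: nat where "width = nat (2 * T_w I + 1)"

text \<open>The first passenger of the group requests no later time than the last, so its
  \<open>t_l\<close> exceeds the \<open>t_e\<close> of the last by at most
  \<open>2 * T_w I\<close>.\<close>

lemma start_times_le_width:
  assumes "k < i" "i \<le> n"
  shows "nat (t_l (i - k) - t_e i + 1) \<le> width"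
proof -
  have "1 \<le> i - k" "i - k \<le> n" "1 \<le> i" using assms by auto
  then show ?thesis
    using t_e_ge[of i] t_l_le[of "i - k"] t_req_mono[of "i - k" i] assms by (simp add: width_def)
qed

text \<open>The test in the program amounts to the existence condition of the head of the zero-arc.
  The 3 steps are the test, the node and the arc.\<close>

lemma extend_group_grows:
  assumes "tables \<sigma>" "k < i" "i \<le> n"
  shows "grows (if is_node (i + 1) (k + 1) then {(i + 1, k + 1)} else {})
           (if is_node (i + 1) (k + 1) then {zero_arc i k} else {}) 3 \<sigma> (extend_group I d i k \<sigma>)"
proof -
  have "i - k \<in> {1..n}" using assms by auto
  then have "tl_tab \<sigma> (i - k) = t_l (i - k)" using assms(1) by (simp add: tables_def)
  then have iff: "(k < v - 1 \<and> i < n \<and> te_tab \<sigma> (i + 1) \<le> tl_tab \<sigma> (i - k)) \<longleftrightarrow> is_node (i + 1) (k + 1)"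
    using assms by (auto simp: tables_def is_node_def)
  show ?thesis
  proof (cases "is_node (i + 1) (k + 1)")
    case True
    then show ?thesis unfolding extend_group_def iff
      using grows_trans[OF grows_trans[OF grows_tick[of \<sigma>] grows_add_node[of "(i + 1, k + 1)"]]
          grows_add_arc[of "zero_arc i k"]]
      by (simp add: zero_arc_def numeral_3_eq_3)
  next
    case False
    then show ?thesis unfolding extend_group_def iff
      using grows_mono[OF grows_tick] by simp
  qed
qed

text \<open>Every start time costs a loop test and an arc; the \<open>+ 1\<close> is the exit
  test.\<close>

lemma close_group_grows:
  assumes "tables \<sigma>" "k < i" "i \<le> n"
  shows "grows {} (one_arc i k ` {t_e i..t_l (i - k)}) (2 * width + 1) \<sigma> (close_group I d i k \<sigma>)"
proof -
  have "i \<in> {1..n}" "i - k \<in> {1..n}" using assms by auto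
  then have tab: "te_tab \<sigma> i = t_e i" "tl_tab \<sigma> (i - k) = t_l (i - k)"
    using assms(1) by (simp_all add: tables_def)
  let ?xs = "[t_e i..t_l (i - k)]"
  have "grows (\<Union>t\<in>set ?xs. {}) (\<Union>t\<in>set ?xs. {one_arc i k t}) (length ?xs * (1 + 1) + 1)
          \<sigma> (for_each ?xs (\<lambda>t. add_arc (one_arc i k t)) \<sigma>)"
    by (rule grows_for_each) (rule grows_add_arc)
  moreover have "(\<Union>t\<in>set ?xs. {one_arc i k t}) = one_arc i k ` {t_e i..t_l (i - k)}"
    by auto
  ultimately show ?thesis
    using start_times_le_width[of k i] assms
    by (auto simp: close_group_def tab one_arc_def elim!: grows_mono)
qed

text \<open>Each of the at most \<open>v\<close> states costs 3 steps for extending,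
  \<open>2 * width + 1\<close> for closing and one loop test. The remaining 2 steps are the node
  with state 0 and the exit test.\<close>

lemma process_layer_grows:
  assumes tab: "tables \<sigma>" and i: "1 \<le> i" "i \<le> n"
    and layer: "{u \<in> built_nodes \<sigma>. fst u = i} = node_layer i"
  shows "grows (node_layer (i + 1)) (\<Union>k\<in>{k. is_node i k}. arcs_from i k)
           (v * (2 * width + 5) + 2) \<sigma> (process_layer I d i \<sigma>)"
proof -
  let ?K = "{k. is_node i k}"
  let ?V = "\<lambda>k. (if is_node (i + 1) (k + 1) then {(i + 1, k + 1)} else {})"
  have size: "layer_size \<sigma> i = card ?K"
    unfolding layer_size_def layer node_layer_def by (rule card_image) (auto simp: inj_on_def)
  have K: "set [0..<card ?K] = ?K"
    unfolding set_upt atLeast0LessThan by (rule is_node_states[symmetric])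
  have "card ?K \<le> card {..<v}" by (rule card_mono) (auto dest: is_nodeD)
  then have cK: "card ?K \<le> v" by simp
  let ?body = "\<lambda>k. close_group I d i k \<circ> extend_group I d i k"
  have body: "grows (?V k) (arcs_from i k) (2 * width + 4) \<sigma>' (?body k \<sigma>')"
    if "tables \<sigma>'" "is_node i k" for k \<sigma>'
  proof -
    have "k < i" using is_nodeD[OF that(2)] by simp
    note 1 = extend_group_grows[OF that(1) this i(2)]
    have "tables (extend_group I d i k \<sigma>')" using tables_grows[OF 1] that(1) by (rule iffD2)
    from grows_trans[OF 1 close_group_grows[OF this \<open>k < i\<close> i(2)]] show ?thesis
      by (simp add: arcs_from_def add_ac)
  qed
  have loop: "grows (\<Union>k\<in>set [0..<card ?K]. ?V k) (\<Union>k\<in>set [0..<card ?K]. arcs_from i k) (length [0..<card ?K] * (2 * width + 4 + 1) + 1)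
      (add_node (i + 1, 0) \<sigma>) (for_each [0..<card ?K] ?body (add_node (i + 1, 0) \<sigma>))"
  proof (rule grows_for_each)
    fix ys k zs \<sigma>'
    assume split: "[0..<card ?K] = ys @ k # zs"
      and grows: "grows (\<Union>k\<in>set ys. ?V k) (\<Union>k\<in>set ys. arcs_from i k)
             (length ys * (2 * width + 4 + 1) + 1) (add_node (i + 1, 0) \<sigma>) \<sigma>'"
    have "tables \<sigma>'"
      unfolding tables_grows[OF grows] tables_grows[OF grows_add_node] by (rule tab)
    moreover have "k \<in> set [0..<card ?K]" unfolding split by simp
    then have "is_node i k" unfolding K by simp
    ultimately show "grows (?V k) (arcs_from i k) (2 * width + 4) \<sigma>' (?body k \<sigma>')"
      by (rule body)
  qed
  \<comment> \<open>By \<open>is_node_pred\<close> every node of layer \<open>i + 1\<close> with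
    positive state is reached by a zero-arc from layer \<open>i\<close>; state 0 is added before the
    loop.\<close>
  have V: "{(i + 1, 0)} \<union> (\<Union>k\<in>?K. ?V k) = node_layer (i + 1)"
  proof -
    have "is_node (i + 1) 0" using i by (simp add: is_node_def)
    moreover have "(i + 1, k) \<in> (\<Union>k\<in>?K. ?V k)" if "is_node (i + 1) k" "k \<noteq> 0" for k
      using that is_node_pred[of i "k - 1"] by (cases k) auto
    ultimately show ?thesis by (auto simp: node_layer_def)
  qed
  have "card ?K * (2 * width + 5) \<le> v * (2 * width + 5)" using cK by (rule mult_le_mono1)
  then have "1 + (length [0..<card ?K] * (2 * width + 4 + 1) + 1) \<le> v * (2 * width + 5) + 2"
    by (simp add: add_ac)
  from grows_mono[OF grows_trans[OF grows_add_node loop[unfolded K]] this] show ?thesis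
    unfolding process_layer_def size V Un_empty_left .
qed

definition initialized :: build_state where
  "initialized = add_node (1, 0) (for_each [1..<n + 1] (compute_times I d) initial_state)"

text \<open>Each passenger costs two table entries and a loop test; the exit test and the root add
  2. The induction treats the first \<open>m\<close> passengers, all other table entries still
  having the default 0.\<close>

lemma initialized_state:
  "tables initialized" "built_nodes initialized = {(1, 0)}" "built_arcs initialized = {}"
  "steps initialized = 3 * n + 2"
proof -
  have "fold (\<lambda>i \<sigma>. compute_times I d i (tick \<sigma>)) [1..<m + 1] initial_state =
      \<lparr>te_tab = (\<lambda>i. if i \<in> {1..m} then t_e i else 0), tl_tab = (\<lambda>i. if i \<in> {1..m} then t_l i else 0),
       built_nodes = {}, built_arcs = {}, steps = 3 * m\<rparr>" for m
    by (induction m)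
      (auto simp: initial_state_def compute_times_def set_te_def set_tl_def tick_def
        t_e_def t_l_def fun_eq_iff)
  from this[of n] show
    "tables initialized" "built_nodes initialized = {(1, 0)}" "built_arcs initialized = {}"
    "steps initialized = 3 * n + 2"
    by (auto simp: for_each_def add_node_def tick_def tables_def initialized_def)
qed

text \<open>Layer \<open>i\<close> is complete before it is processed: it is the root alone for
  \<open>i = 1\<close> and otherwise comes entirely from iteration \<open>i - 1\<close>. The 3
  consists of the 2 extra steps of a layer and its loop test.\<close>

lemma algorithm_A_grows:
  "grows (\<Union>i\<in>{1..n}. node_layer (i + 1)) (\<Union>i\<in>{1..n}. \<Union>k\<in>{k. is_node i k}. arcs_from i k)
     (n * (v * (2 * width + 5) + 3) + 1) initialized (algorithm_A I d)"
proof -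
  let ?A = "\<lambda>i. \<Union>k\<in>{k. is_node i k}. arcs_from i k" and ?c = "v * (2 * width + 5) + 2"
  have set: "set [1..<n + 1] = {1..n}" by auto
  have "grows (\<Union>i\<in>set [1..<n + 1]. node_layer (i + 1)) (\<Union>i\<in>set [1..<n + 1]. ?A i)
     (length [1..<n + 1] * (?c + 1) + 1) initialized (for_each [1..<n + 1] (process_layer I d) initialized)"
  proof (rule grows_for_each)
    fix ys i zs \<sigma>'
    assume split: "[1..<n + 1] = ys @ i # zs"
      and grows: "grows (\<Union>i\<in>set ys. node_layer (i + 1)) (\<Union>i\<in>set ys. ?A i)
                    (length ys * (?c + 1) + 1) initialized \<sigma>'"
    have "i \<in> set [1..<n + 1]" unfolding split by simp
    then have i: "1 \<le> i" "i \<le> n" by auto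
    \<comment> \<open>The entries of the list are distinct, so \<open>i\<close> determines the
      prefix \<open>ys\<close>, that is, the layers processed so far.\<close>
    have "[1..<n + 1] = [1..<i] @ i # [i + 1..<n + 1]"
      using i upt_add_eq_append[of 1 i "n + 1 - i"] by (simp add: upt_conv_Cons)
    then have ys: "set ys = {1..<i}"
      using split by (metis append_Cons_eq_iff distinct_upt distinct.simps(2) distinct_append
          not_distinct_conv_prefix set_upt)
    have "is_node 1 k \<longleftrightarrow> k = 0" for k by (auto simp: is_node_def)
    then have 1: "node_layer 1 = {(1, 0)}" by (auto simp: node_layer_def)
    have "{u \<in> built_nodes \<sigma>'. fst u = i} = node_layer i"
    proof (cases "i = 1")
      case True
      then show ?thesis using grows ys initialized_state(2) 1 by (auto simp: grows_def)
    next
      case False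
      have "built_nodes \<sigma>' = {(1, 0)} \<union> (\<Union>i\<in>{1..<i}. node_layer (i + 1))"
        using grows initialized_state(2) by (simp add: grows_def ys)
      moreover have "{u \<in> node_layer (m + 1). fst u = i} = (if m + 1 = i then node_layer i else {})" for m
        by (auto simp: node_layer_def)
      moreover have "{u \<in> {(1, 0)} \<union> (\<Union>i\<in>{1..<i}. node_layer (i + 1)). fst u = i} =
          (\<Union>m\<in>{1..<i}. {u \<in> node_layer (m + 1). fst u = i})"
        using False by auto
      ultimately have "{u \<in> built_nodes \<sigma>'. fst u = i} =
          (\<Union>m\<in>{1..<i}. if m + 1 = i then node_layer i else {})"
        by (simp only:)
      moreover have "i - 1 \<in> {1..<i}" "i - 1 + 1 = i" using i False by auto
      then have "(\<Union>m\<in>{1..<i}. if m + 1 = i then node_layer i else {}) = node_layer i"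
        using UN_upper[of "i - 1" "{1..<i}" "\<lambda>m. if m + 1 = i then node_layer i else {}"]
        by (intro equalityI UN_least) (auto split: if_splits)
      ultimately show ?thesis by (simp only:)
    qed
    moreover have "tables \<sigma>'" using tables_grows[OF grows] initialized_state(1) by simp
    ultimately show "grows (node_layer (i + 1)) (?A i) ?c \<sigma>' (process_layer I d i \<sigma>')"
      using i by (intro process_layer_grows)
  qed
  moreover have "length [1..<n + 1] * (?c + 1) + 1 = n * (v * (2 * width + 5) + 3) + 1"
    by (simp add: add_mult_distrib2)
  ultimately show ?thesis by (simp only: set algorithm_A_def flip: initialized_def)
qed

section \<open>Nodes, arcs and size of the diagram\<close>

abbreviation D :: "(node, dd_arc) decision_diagram" where "D \<equiv> constructed_diagram I d"

lemma nodes_D: "verts (dgraph D) = {(i, k). is_node i k}"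
proof -
  have "verts (dgraph D) = {(1, 0)} \<union> (\<Union>i\<in>{1..n}. node_layer (i + 1))"
    using algorithm_A_grows initialized_state(2) by (simp add: constructed_diagram_def grows_def)
  moreover have "(i, k) \<in> (\<Union>i\<in>{1..n}. node_layer (i + 1))" if "is_node i k" "(i, k) \<noteq> (1, 0)" for i k
  proof -
    have "i \<noteq> 1" using that by (auto simp: is_node_def)
    then have "i - 1 \<in> {1..n}" "i - 1 + 1 = i" using that by (auto simp: is_node_def)
    then show ?thesis using that by (force simp: node_layer_def)
  qed
  moreover have "is_node 1 0" by (simp add: is_node_def)
  ultimately show ?thesis by (auto simp: node_layer_def)
qed

text \<open>For zero-arcs the existence of the head suffices as a condition, since
  \<open>is_node_pred\<close> supplies the tail.\<close>

lemma arcs_D: "arcs (dgraph D) =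
   {zero_arc i k | i k. is_node (i + 1) (k + 1)} \<union>
   {one_arc i k t | i k t. is_node i k \<and> i \<le> n \<and> t_e i \<le> t \<and> t \<le> t_l (i - k)}"
  (is "_ = ?Z \<union> ?O")
proof -
  have "arcs (dgraph D) = (\<Union>i\<in>{1..n}. \<Union>k\<in>{k. is_node i k}. arcs_from i k)"
    using algorithm_A_grows initialized_state(3) by (simp add: constructed_diagram_def grows_def)
  also have "\<dots> = ?Z \<union> ?O"
  proof (intro equalityI subsetI)
    fix a assume "a \<in> (\<Union>i\<in>{1..n}. \<Union>k\<in>{k. is_node i k}. arcs_from i k)"
    then obtain i k where "i \<le> n" "is_node i k" "a \<in> arcs_from i k" by auto
    then show "a \<in> ?Z \<union> ?O" by (auto simp: arcs_from_def split: if_splits)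
  next
    fix a assume "a \<in> ?Z \<union> ?O"
    then consider (zero) i k where "a = zero_arc i k" "is_node (i + 1) (k + 1)"
      | (one) i k t where "a = one_arc i k t" "is_node i k" "i \<le> n" "t_e i \<le> t" "t \<le> t_l (i - k)"
      by blast
    then show "a \<in> (\<Union>i\<in>{1..n}. \<Union>k\<in>{k. is_node i k}. arcs_from i k)"
    proof cases
      case zero
      then have "is_node i k" "i \<in> {1..n}" using is_node_pred[of i k] by (auto simp: is_node_def)
      moreover have "a \<in> arcs_from i k" using zero by (simp add: arcs_from_def)
      ultimately show ?thesis by blast
    next
      case one
      then have "i \<in> {1..n}" by (auto simp: is_node_def)
      moreover have "a \<in> arcs_from i k" using one by (simp add: arcs_from_def)
      ultimately show ?thesis using one by blast
    qed
  qed
  finally show ?thesis .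
qed

lemma D_simps [simp]:
  "tail (dgraph D) = source" "head (dgraph D) = target" "layer_of D = fst" "node_state D = snd"
  "dd_root D = (1, 0)" "dd_terminal D = (n + 1, 0)" "start_time D = dep_at"
  "one_arcs D = {a \<in> arcs (dgraph D). is_one_arc a}"
  by (simp_all add: constructed_diagram_def)

lemma arc_simps [simp]:
  "source (zero_arc i k) = (i, k)" "target (zero_arc i k) = (i + 1, k + 1)"
  "\<not> is_one_arc (zero_arc i k)"
  "source (one_arc i k t) = (i, k)" "target (one_arc i k t) = (i + 1, 0)"
  "is_one_arc (one_arc i k t)" "dep_at (one_arc i k t) = t"
  by (simp_all add: zero_arc_def one_arc_def)

lemma card_nodes: "finite (verts (dgraph D))" "card (verts (dgraph D)) \<le> (n + 1) * v"
proof -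
  have sub: "verts (dgraph D) \<subseteq> {1..n + 1} \<times> {..<v}"
    unfolding nodes_D by (auto dest: is_nodeD)
  show "finite (verts (dgraph D))" by (rule finite_subset[OF sub]) simp
  show "card (verts (dgraph D)) \<le> (n + 1) * v" using card_mono[OF _ sub] by simp
qed

lemma finite_arcs_D: "finite (arcs (dgraph D))"
proof -
  have "finite (arcs_from i k)" for i k by (simp add: arcs_from_def)
  moreover have "finite {k. is_node i k}" for i
    by (subst is_node_states) simp
  ultimately show ?thesis
    using algorithm_A_grows initialized_state(3) by (simp add: constructed_diagram_def grows_def)
qed

lemma running_time_le: "running_time I d \<le> n * (v * (2 * width + 5) + 6) + 3"
  using algorithm_A_grows initialized_state(4)
  by (simp add: running_time_def grows_def algebra_simps)

text \<open>The construction starts without arcs and pays a step for each new one.\<close>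

lemma card_arcs_le: "card (arcs (dgraph D)) \<le> running_time I d"
proof -
  have "card (built_arcs (algorithm_A I d)) + steps initialized
      \<le> card (built_arcs initialized) + steps (algorithm_A I d)"
    using algorithm_A_grows unfolding grows_def by blast
  then show ?thesis
    by (simp add: running_time_def constructed_diagram_def initialized_state(3))
qed

section \<open>Layered structure and maximal paths\<close>

lemma layered: "layered_diagram v n D"
proof -
  have "wf_digraph (dgraph D)"
  proof
    fix a assume a: "a \<in> arcs (dgraph D)"
    show "tail (dgraph D) a \<in> verts (dgraph D)"
      using a is_node_pred by (auto simp: arcs_D nodes_D)
    show "head (dgraph D) a \<in> verts (dgraph D)"
      using a by (auto simp: arcs_D nodes_D) (auto simp: is_node_def)
  qed
  then have "fin_digraph (dgraph D)"
    using card_nodes(1) finite_arcs_D by (rule wf_digraph.fin_digraphI)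
  moreover have "layer D 1 = {dd_root D}" "layer D (n + 1) = {dd_terminal D}"
    by (auto simp: layer_def nodes_D is_node_def)
  moreover have "layer_of D ` verts (dgraph D) \<subseteq> {1..n + 1}" "\<forall>u \<in> verts (dgraph D). node_state D u < v"
    by (auto simp: nodes_D dest: is_nodeD)
  moreover have "\<forall>a\<in>arcs (dgraph D). layer_of D (head (dgraph D) a) = arc_layer D a + 1"
    by (auto simp: arcs_D arc_layer_def)
  moreover have "\<forall>a \<in> one_arcs D. node_state D (tail (dgraph D) a) < arc_layer D a"
    by (auto simp: arcs_D arc_layer_def dest: is_nodeD)
  ultimately show ?thesis unfolding layered_diagram_def by auto
qed

text \<open>The assumption lets every passenger depart alone, which gives a one-arc between the
  state-0 nodes of consecutive layers. If \<open>t_e i > t_l i\<close> held, the node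
  \<open>(i, 0)\<close> would be a dead end, since for \<open>i < n\<close> also
  \<open>t_e (i + 1) > t_l i\<close>.\<close>

lemma decision_diagram:
  assumes le_tl: "\<forall>j \<in> passengers_to I d. earliest_dep I j \<le> latest_dep I j"
  shows "is_decision_diagram v n D"
proof -
  have le: "t_e i \<le> t_l i" if "1 \<le> i" "i \<le> n" for i
    using le_tl J_mem[OF that] by (simp add: t_e_def t_l_def)
  have "w = dd_root D" if w: "w \<in> verts (dgraph D)" "\<forall>a\<in>arcs (dgraph D). head (dgraph D) a \<noteq> w" for w
  proof (rule ccontr)
    obtain i k where ik: "w = (i, k)" "is_node i k" using w(1) by (auto simp: nodes_D)
    assume "w \<noteq> dd_root D"
    then have "(i, k) \<noteq> (1, 0)" using ik by simp
    then have i: "1 < i" using ik by (auto simp: is_node_def)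
    show False
    proof (cases k)
      case 0
      have "is_node (i - 1) 0" "i - 1 \<le> n" "t_e (i - 1) \<le> t_l (i - 1 - 0)"
        using ik i le[of "i - 1"] by (auto simp: is_node_def)
      then have "one_arc (i - 1) 0 (t_e (i - 1)) \<in> arcs (dgraph D)"
        unfolding arcs_D by blast
      then show False using w(2) ik 0 i by fastforce
    next
      case (Suc k')
      have "zero_arc (i - 1) k' \<in> arcs (dgraph D)" unfolding arcs_D using ik i Suc by fastforce
      then show False using w(2) ik Suc i by fastforce
    qed
  qed
  moreover have "w = dd_terminal D"
    if w: "w \<in> verts (dgraph D)" "\<forall>a\<in>arcs (dgraph D). tail (dgraph D) a \<noteq> w" for w
  proof (rule ccontr)
    obtain i k where ik: "w = (i, k)" "is_node i k" using w(1) by (auto simp: nodes_D)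
    assume "w \<noteq> dd_terminal D"
    then have i: "i \<le> n" using ik by (auto simp: is_node_def)
    \<comment> \<open>For \<open>k > 0\<close> this is part of \<open>is_node\<close>; for
      \<open>k = 0\<close> it is the assumption.\<close>
    then have "t_e i \<le> t_l (i - k)" using ik le[of i] by (auto simp: is_node_def)
    then have "one_arc i k (t_e i) \<in> arcs (dgraph D)" using ik i unfolding arcs_D by blast
    then show False using w(2) ik by fastforce
  qed
  moreover have "u \<in> verts (dgraph D) \<and> w \<in> verts (dgraph D)"
    if "pre_digraph.awalk (dgraph D) u p w" for u p w
  proof -
    interpret fin_digraph "dgraph D" using layered by (simp add: layered_diagram_def)
    show ?thesis using that by auto
  qed
  ultimately show ?thesis
    using layered unfolding is_decision_diagram_def maximal_path_def by blast
qed


section \<open>Root-to-terminal paths\<close>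

text \<open>Working with indices turns groups into intervals; injectivity of \<open>J\<close>
  carries the results back to passengers.\<close>

definition indices :: "dd_arc \<Rightarrow> nat set" where
  "indices a = {fst (source a) - snd (source a)..fst (source a)}"

lemma arc_group_indices: "arc_group I d D a = J ` indices a"
  by (simp add: arc_group_def group_at_def arc_layer_def indices_def)

text \<open>A partial path from \<open>u\<^sub>i\<^sup>k\<close> also accounts for the \<open>k\<close> passengers that are waiting at \<open>u\<^sub>i\<^sup>k\<close>.\<close>

lemma walk_covers:
  assumes "pre_digraph.cas (dgraph D) (i, k) p (i', k')" "set p \<subseteq> arcs (dgraph D)"
  shows "i - k \<le> i' - k' \<and>
    (\<forall>a\<in>set p. is_one_arc a \<longrightarrow> indices a \<subseteq> {i - k..<i' - k'}) \<and>
    (\<forall>m\<in>{i - k..<i' - k'}. \<exists>!a. a \<in> set p \<and> is_one_arc a \<and> m \<in> indices a)"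
  using assms
proof (induction p arbitrary: i k)
  case Nil
  then show ?case by (simp add: pre_digraph.cas.simps)
next
  case (Cons a p)
  have a: "a \<in> arcs (dgraph D)" "source a = (i, k)"
    and cas: "pre_digraph.cas (dgraph D) (target a) p (i', k')"
    and p: "set p \<subseteq> arcs (dgraph D)"
    using Cons.prems by (auto simp: pre_digraph.cas.simps)
  from a(1) consider (zero) j l where "a = zero_arc j l" | (one) j l t where "a = one_arc j l t"
    by (auto simp: arcs_D)
  then show ?case
  proof cases
    \<comment> \<open>The difference \<open>i - k\<close> is unchanged and no index is covered, so
      the induction hypothesis carries over.\<close>
    case zero
    with a cas have "a = zero_arc i k" "pre_digraph.cas (dgraph D) (i + 1, k + 1) p (i', k')" by auto
    with Cons.IH[OF this(2) p] show ?thesis by auto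
  next
    case one
    with a cas have "is_one_arc a" and "pre_digraph.cas (dgraph D) (i + 1, 0) p (i', k')" by auto
    \<comment> \<open>The one-arc covers exactly the indices below \<open>i + 1\<close>, where the
      rest of the walk starts with nobody waiting.\<close>
    have ind: "indices a = {i - k..<i + 1}" using a by (auto simp: indices_def)
    from Cons.IH[OF \<open>pre_digraph.cas (dgraph D) (i + 1, 0) p (i', k')\<close> p]
    have IH: "i + 1 \<le> i' - k'"
      "\<forall>a\<in>set p. is_one_arc a \<longrightarrow> indices a \<subseteq> {i + 1..<i' - k'}"
      "\<forall>m\<in>{i + 1..<i' - k'}. \<exists>!a. a \<in> set p \<and> is_one_arc a \<and> m \<in> indices a"
      by auto
    have "\<exists>!b. b \<in> set (a # p) \<and> is_one_arc b \<and> m \<in> indices b" if m: "m \<in> {i - k..<i' - k'}" for m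
    proof (cases "m < i + 1")
      case True
      then have "m \<in> indices a" using m ind by simp
      moreover have "m \<notin> indices b" if "b \<in> set p" "is_one_arc b" for b
        using that IH(2) True by fastforce
      ultimately show ?thesis using \<open>is_one_arc a\<close> by (intro ex1I[of _ a]) auto
    next
      case False
      then have "m \<notin> indices a" using ind by simp
      moreover have "\<exists>!b. b \<in> set p \<and> is_one_arc b \<and> m \<in> indices b" using IH(3) m False by simp
      ultimately show ?thesis by auto
    qed
    moreover have "\<forall>b\<in>set (a # p). is_one_arc b \<longrightarrow> indices b \<subseteq> {i - k..<i' - k'}"
      using ind IH(1,2) by fastforce
    ultimately show ?thesis using IH(1) by auto
  qed
qed

text \<open>The difference \<open>i - k\<close> is 1 at the root and \<open>n + 1\<close> at the
  terminal, so the half-open interval of \<open>walk_covers\<close> becomes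
  \<open>{1..n}\<close>.\<close>

lemma path_covers:
  assumes "p \<in> root_terminal_paths D"
  shows "\<And>a. a \<in> path_one_arcs D p \<Longrightarrow> indices a \<subseteq> {1..n}"
    and "\<And>m. m \<in> {1..n} \<Longrightarrow> \<exists>!a. a \<in> path_one_arcs D p \<and> m \<in> indices a"
proof -
  have "pre_digraph.cas (dgraph D) (1, 0) p (n + 1, 0)" and p: "set p \<subseteq> arcs (dgraph D)"
    using assms by (auto simp: root_terminal_paths_def pre_digraph.awalk_def)
  from walk_covers[OF this]
  have cov: "\<forall>a\<in>set p. is_one_arc a \<longrightarrow> indices a \<subseteq> {1..n}"
    "\<forall>m\<in>{1..n}. \<exists>!a. a \<in> set p \<and> is_one_arc a \<and> m \<in> indices a"
    by (simp_all add: atLeastLessThanSuc_atLeastAtMost)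
  have one: "a \<in> path_one_arcs D p \<longleftrightarrow> a \<in> set p \<and> is_one_arc a" for a
    using p by (auto simp: path_one_arcs_def)
  show "indices a \<subseteq> {1..n}" if "a \<in> path_one_arcs D p" for a
    using cov(1) that by (simp add: one)
  show "\<exists>!a. a \<in> path_one_arcs D p \<and> m \<in> indices a" if "m \<in> {1..n}" for m
    using cov(2) that by (simp add: one)
qed

section \<open>Groups and arrival times along a path\<close>

lemma mem_arc_group_iff:
  assumes "p \<in> root_terminal_paths D" "a \<in> path_one_arcs D p" "m \<in> {1..n}"
  shows "J m \<in> arc_group I d D a \<longleftrightarrow> m \<in> indices a"
proof -
  have "indices a \<subseteq> {1..n}" using assms(1,2) by (rule path_covers(1))
  then show ?thesis
    unfolding arc_group_indices by (rule inj_on_image_mem_iff[OF J_inj assms(3)])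
qed

text \<open>Groups of a path that share a passenger come from one-arcs covering the same index, and
  there is only one such arc.\<close>

lemma DD1: "DD1 I d D"
  unfolding DD1_def
proof (intro ballI)
  fix p j assume p: "p \<in> root_terminal_paths D" and j: "j \<in> passengers_to I d"
  from j obtain m where m: "m \<in> {1..n}" "j = J m" by (rule J_E)
  from path_covers(2)[OF p m(1)] obtain a where a: "a \<in> path_one_arcs D p" "m \<in> indices a"
    and uniq: "\<And>b. b \<in> path_one_arcs D p \<Longrightarrow> m \<in> indices b \<Longrightarrow> b = a" by blast
  show "\<exists>!g. g \<in> path_groups I d D p \<and> j \<in> g"
  proof (rule ex1I[of _ "arc_group I d D a"])
    show "arc_group I d D a \<in> path_groups I d D p \<and> j \<in> arc_group I d D a"
      using a m mem_arc_group_iff[OF p] by (auto simp: path_groups_def)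
    show "g = arc_group I d D a" if "g \<in> path_groups I d D p \<and> j \<in> g" for g
      using that uniq m mem_arc_group_iff[OF p] by (auto simp: path_groups_def)
  qed
qed

text \<open>The start time lies between \<open>t_e\<close> of the last and \<open>t_l\<close> of the
  first passenger of the group; monotonicity puts it into the window of every member.\<close>

lemma one_arc_times:
  assumes "a \<in> one_arcs D" "m \<in> indices a"
  shows "t_e m \<le> dep_at a \<and> dep_at a \<le> t_l m"
proof -
  obtain i k t where a: "a = one_arc i k t" and ik: "is_node i k" "i \<le> n" "t_e i \<le> t" "t \<le> t_l (i - k)"
    using assms(1) by (auto simp: arcs_D)
  have "k < i" using ik(1) by (auto dest: is_nodeD)
  moreover have "i - k \<le> m" "m \<le> i" using assms(2) a by (auto simp: indices_def)
  ultimately have "t_e m \<le> t_e i" "t_l (i - k) \<le> t_l m"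
    using ik(2) by (auto intro!: t_e_mono t_l_mono)
  with ik a show ?thesis by auto
qed

lemma DD2: "DD2 I d D"
  unfolding DD2_def
proof (intro ballI impI conjI)
  fix p j g
  assume p: "p \<in> root_terminal_paths D" and j: "j \<in> passengers_to I d"
    and g: "g \<in> path_groups I d D p" "j \<in> g"
  from j obtain m where m: "m \<in> {1..n}" "j = J m" by (rule J_E)
  \<comment> \<open>Every one-arc of the path that selects \<open>g\<close> covers \<open>m\<close>,
    so uniqueness of the covering arc gives uniqueness of the selecting arc.\<close>
  have mem: "m \<in> indices a" if "a \<in> path_one_arcs D p" "arc_group I d D a = g" for a
    using mem_arc_group_iff[OF p that(1) m(1)] that g m by auto
  show "\<exists>!a. a \<in> path_one_arcs D p \<and> arc_group I d D a = g"
    using g path_covers(2)[OF p m(1)] mem by (auto simp: path_groups_def)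
  fix a assume a: "a \<in> path_one_arcs D p" "arc_group I d D a = g"
  then have "t_e m \<le> dep_at a \<and> dep_at a \<le> t_l m"
    using mem[OF a] by (intro one_arc_times) (auto simp: path_one_arcs_def)
  then show "t_req I j - T_w I \<le> start_time D a + travel_time I d"
    "start_time D a + travel_time I d \<le> t_req I j + T_w I"
    using t_e_ge[of m] t_l_le[of m] m by auto
qed

text \<open>In layer \<open>i\<close> the path takes the zero-arc if \<open>i\<close> is not the
  last index of its block, and otherwise the one-arc with the prescribed start time.\<close>

lemma DD3: "DD3 I d D"
  unfolding DD3_def
proof (intro ballI allI impI)
  fix P \<theta>
  assume P: "P \<in> group_partitions I d" and \<theta>: "\<forall>g \<in> P. can_depart_at I g (\<theta> g)"
  have part: "partition_on (passengers_to I d) P"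
    and contig: "\<And>g. g \<in> P \<Longrightarrow> contiguous I d g" and board: "\<And>g. g \<in> P \<Longrightarrow> can_board I g"
    using P by (auto simp: group_partitions_def)
  have "\<exists>a b. 1 \<le> a \<and> a \<le> i \<and> i \<le> b \<and> b \<le> n \<and> J ` {a..b} \<in> P" if i: "i \<in> {1..n}" for i
  proof -
    obtain g where g: "g \<in> P" "J i \<in> g" using part i J_image unfolding partition_on_def by blast
    then obtain a b where ab: "1 \<le> a" "a \<le> b" "b \<le> n" "g = J ` {a..b}"
      using contig unfolding contiguous_def by blast
    have "{a..b} \<subseteq> {1..n}" using ab by auto
    then have "i \<in> {a..b}" using inj_on_image_mem_iff[OF J_inj i, of "{a..b}"] g ab by auto
    with ab g show ?thesis by auto
  qed
  \<comment> \<open>These are the first and the last index of the block containing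
    \<open>i\<close>.\<close>
  then obtain lo hi where lohi: "\<And>i. i \<in> {1..n} \<Longrightarrow>
      1 \<le> lo i \<and> lo i \<le> i \<and> i \<le> hi i \<and> hi i \<le> n \<and> J ` {lo i..hi i} \<in> P"
    by metis
  \<comment> \<open>Blocks sharing \<open>J i\<close> coincide by disjointness, and injectivity of
    \<open>J\<close> then identifies the intervals.\<close>
  have uniq: "a = lo i \<and> b = hi i"
    if "1 \<le> a" "a \<le> i" "i \<le> b" "b \<le> n" "J ` {a..b} \<in> P" for a b i
  proof -
    have i: "i \<in> {1..n}" using that by auto
    note l = lohi[OF i]
    have "J i \<in> J ` {a..b}" "J i \<in> J ` {lo i..hi i}" using that l by auto
    then have "J ` {a..b} = J ` {lo i..hi i}"
      using disjointD[OF partition_onD2[OF part] that(5), of "J ` {lo i..hi i}"] l by blast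
    then have "{a..b} = {lo i..hi i}"
      using inj_on_image_eq_iff[OF J_inj, of "{a..b}" "{lo i..hi i}"] that l by auto
    then show ?thesis using that by simp
  qed
  define gr where "gr i = J ` {lo i..hi i}" for i
  define arc where "arc i = (if i < hi i then zero_arc i (i - lo i)
                              else one_arc i (i - lo i) (\<theta> (gr i)))" for i
  \<comment> \<open>Layer \<open>n + 1\<close> belongs to no block, so the state of the terminal is
    set to 0 separately.\<close>
  define nd where "nd i = (i, if i \<le> n then i - lo i else 0)" for i
  have gr: "t_e (hi i) \<le> \<theta> (gr i) \<and> \<theta> (gr i) \<le> t_l (lo i) \<and> hi i - lo i < v" if i: "i \<in> {1..n}" for i
  proof -
    note l = lohi[OF i]
    then have "gr i \<in> P" by (simp add: gr_def)
    then have "can_depart_at I (gr i) (\<theta> (gr i))" "can_board I (gr i)" using \<theta> board by blast+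
    then have "Max (earliest_dep I ` gr i) \<le> \<theta> (gr i)" "\<theta> (gr i) \<le> Min (latest_dep I ` gr i)"
      "card (gr i) \<le> v"
      by (simp_all add: can_depart_at_def can_board_def)
    moreover have "J (lo i) \<in> gr i" "J (hi i) \<in> gr i" "finite (gr i)" using l by (auto simp: gr_def)
    then have "t_e (hi i) \<le> Max (earliest_dep I ` gr i)" "Min (latest_dep I ` gr i) \<le> t_l (lo i)"
      by (simp_all add: t_e_def t_l_def)
    moreover have "{lo i..hi i} \<subseteq> {1..n}" using l by auto
    then have "card (gr i) = hi i + 1 - lo i"
      unfolding gr_def using card_image[OF inj_on_subset[OF J_inj]] by simp
    ultimately show ?thesis using l by linarith
  qed
  have node: "is_node i (i - lo i)" if i: "i \<in> {1..n}" for i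
  proof -
    note l = lohi[OF i]
    \<comment> \<open>The time of the whole block also suits its waiting part: \<open>t_e i \<le>
      t_e (hi i) \<le> \<theta> (gr i) \<le> t_l (lo i)\<close>.\<close>
    have "t_e i \<le> t_e (hi i)" using l i by (intro t_e_mono) auto
    then show ?thesis using gr[OF i] l i by (auto simp: is_node_def)
  qed
  have lo_Suc: "lo (Suc i) = lo i" if "i \<in> {1..n}" "i < hi i" for i
    using uniq[of "lo i" "Suc i" "hi i"] lohi[of i] that by auto
  \<comment> \<open>If the block of \<open>Suc i\<close> began at or before \<open>i\<close>, it
    would be the block of \<open>i\<close>, which ends at \<open>i\<close>.\<close>
  have lo_Suc': "lo (Suc i) = Suc i" if i: "i \<in> {1..n}" "\<not> i < hi i" "i < n" for i
  proof (rule ccontr)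
    assume "lo (Suc i) \<noteq> Suc i"
    then have "hi (Suc i) = hi i"
      using uniq[of "lo (Suc i)" i "hi (Suc i)"] lohi[of "Suc i"] i by auto
    then show False using lohi[of "Suc i"] i by auto
  qed
  have arc_in: "arc i \<in> arcs (dgraph D)" if i: "i \<in> {1..n}" for i
  proof (cases "i < hi i")
    case True
    have "Suc i \<in> {1..n}" using True lohi[OF i] by auto
    from node[OF this] have "is_node (i + 1) (i - lo i + 1)"
      using lo_Suc[OF i True] lohi[OF i] by (simp add: Suc_diff_le)
    then show ?thesis using True unfolding arc_def arcs_D by auto
  next
    case False
    then have "hi i = i" using lohi[OF i] by auto
    then have "t_e i \<le> \<theta> (gr i)" "\<theta> (gr i) \<le> t_l (i - (i - lo i))" using gr[OF i] lohi[OF i] by auto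
    then show ?thesis using False node[OF i] i unfolding arc_def arcs_D by auto
  qed
  have ends: "source (arc i) = nd i \<and> target (arc i) = nd (Suc i)" if i: "i \<in> {1..n}" for i
    using lo_Suc[OF i] lo_Suc'[OF i] lohi[OF i] i
    by (auto simp: arc_def nd_def Suc_diff_le)
  have cas: "pre_digraph.cas (dgraph D) (nd m) (map arc [m..<m + l]) (nd (m + l))"
    if "1 \<le> m" "m + l \<le> n + 1" for m l
    using that
  proof (induction l arbitrary: m)
    case 0
    then show ?case by (simp add: pre_digraph.cas.simps)
  next
    case (Suc l)
    have "[m..<m + Suc l] = m # [Suc m..<Suc m + l]" by (simp add: upt_conv_Cons)
    then show ?case using Suc.IH[of "Suc m"] Suc.prems ends[of m]
      by (simp add: pre_digraph.cas.simps)
  qed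
  let ?p = "map arc [1..<1 + n]"
  have set_p: "set ?p = arc ` {1..n}" by auto
  have "nd 1 = (1, 0)" using lohi[of 1] by (auto simp: nd_def)
  moreover have "nd (1 + n) = (n + 1, 0)" by (simp add: nd_def)
  ultimately have path: "?p \<in> root_terminal_paths D"
    using cas[of 1 n] arc_in unfolding root_terminal_paths_def pre_digraph.awalk_def set_p
    by (auto simp: nodes_D is_node_def)
  \<comment> \<open>One-arcs occur exactly in the layers that end a block.\<close>
  have one_arcs: "path_one_arcs D ?p = (\<lambda>i. one_arc i (i - lo i) (\<theta> (gr i))) ` {i \<in> {1..n}. hi i = i}"
  proof -
    have "is_one_arc (arc i) \<longleftrightarrow> \<not> i < hi i" for i by (simp add: arc_def)
    moreover have "path_one_arcs D ?p = {a \<in> arc ` {1..n}. is_one_arc a}"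
      using arc_in unfolding path_one_arcs_def set_p D_simps by blast
    ultimately have "path_one_arcs D ?p = arc ` {i \<in> {1..n}. \<not> i < hi i}" by auto
    moreover have "{i \<in> {1..n}. \<not> i < hi i} = {i \<in> {1..n}. hi i = i}" using lohi by force
    ultimately show ?thesis by (auto simp: arc_def)
  qed
  have group: "arc_group I d D (one_arc i (i - lo i) t) = gr i" if "i \<in> {1..n}" "hi i = i" for i t
    using lohi[OF that(1)] that(2) by (simp add: arc_group_indices indices_def gr_def)
  have "path_groups I d D ?p = gr ` {i \<in> {1..n}. hi i = i}"
    unfolding path_groups_def one_arcs image_image using group by (intro image_cong) auto
  also have "\<dots> = P"
  proof
    show "gr ` {i \<in> {1..n}. hi i = i} \<subseteq> P" using lohi unfolding gr_def by blast
    show "P \<subseteq> gr ` {i \<in> {1..n}. hi i = i}"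
    proof
      fix g assume g: "g \<in> P"
      then obtain a b where ab: "1 \<le> a" "a \<le> b" "b \<le> n" "g = J ` {a..b}"
        using contig unfolding contiguous_def by blast
      \<comment> \<open>The right end \<open>b\<close> represents its block.\<close>
      with g uniq[of a b b] have "a = lo b" "b = hi b" by auto
      then show "g \<in> gr ` {i \<in> {1..n}. hi i = i}" using ab by (intro image_eqI[of _ _ b]) (auto simp: gr_def)
    qed
  qed
  finally have "path_groups I d D ?p = P" .
  moreover have "\<forall>a \<in> path_one_arcs D ?p. start_time D a = \<theta> (arc_group I d D a)"
    unfolding one_arcs using group by auto
  ultimately show "\<exists>p\<in>root_terminal_paths D. path_groups I d D p = P \<and>
      (\<forall>a\<in>path_one_arcs D p. start_time D a = \<theta> (arc_group I d D a))"
    using path by blast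
qed

section \<open>Explicit constants for the asymptotic bounds\<close>

lemma n_le: "n \<le> card (passengers I)"
  unfolding n_to_def passengers_to_def using valid
  by (intro card_mono) (auto simp: valid_instance_def)

lemma card_nodes_bound:
  assumes "1 \<le> n"
  shows "real (card (verts (dgraph D))) \<le> 2 * (real n * real v)"
proof -
  \<comment> \<open>Since \<open>1 \<le> n\<close>, the extra layer costs at most a factor
    2.\<close>
  have "1 * v \<le> n * v" using assms by (intro mult_right_mono) auto
  then have "(n + 1) * v \<le> 2 * (n * v)" by simp
  with card_nodes(2) have "card (verts (dgraph D)) \<le> 2 * (n * v)" by (rule le_trans)
  then have "real (card (verts (dgraph D))) \<le> real (2 * (n * v))" by (rule of_nat_mono)
  then show ?thesis by simp
qed

lemma running_time_bound:
  assumes "1 \<le> n" "1 \<le> T_w I"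
  shows "real (running_time I d) \<le> 20 * (real n * real v * real_of_int (T_w I))"
proof -
  define T where "T = nat (T_w I)"
  have T: "1 \<le> T" "width = 2 * T + 1" "real_of_int (T_w I) = real T"
    using assms by (auto simp: T_def width_def)
  \<comment> \<open>Each monomial is at most \<open>n * v * T\<close>, and the coefficients add up
    to 4 + 7 + 6 + 3 = 20.\<close>
  have "n * (v * (2 * width + 5) + 6) + 3 = 4 * (n * v * T) + 7 * (n * v) + 6 * n + 3"
    by (simp add: T algebra_simps)
  also have "\<dots> \<le> 20 * (n * v * T)"
  proof -
    have 1: "n * v \<le> n * v * T" "n \<le> n * v" using T(1) v_pos by auto
    then show ?thesis using assms(1) by linarith
  qed
  finally have "running_time I d \<le> 20 * (n * v * T)" using running_time_le by linarith
  then have "real (running_time I d) \<le> real (20 * (n * v * T))" by (rule of_nat_mono)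
  then show ?thesis by (simp add: T)
qed

end

theorem theorem4:
  shows "(\<forall>(I :: ('c, 's, 'd, 'p) transit_instance) d. valid_instance I \<and> d \<in> destinations I \<longrightarrow>
            layered_diagram (v_cap I) (n_to I d) (constructed_diagram I d) \<and>
            ((\<forall>j \<in> passengers_to I d. earliest_dep I j \<le> latest_dep I j) \<longrightarrow>
               is_decision_diagram (v_cap I) (n_to I d) (constructed_diagram I d)) \<and>
            DD1 I d (constructed_diagram I d) \<and>
            DD2 I d (constructed_diagram I d) \<and>
            DD3 I d (constructed_diagram I d)) \<and>
         (\<lambda>(I :: ('c, 's, 'd, 'p) transit_instance, d). real (card (verts (dgraph (constructed_diagram I d)))))
           \<in> O[principal asymptotic_domain](\<lambda>(I, d). real (n_to I d) * real (v_cap I)) \<and>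
         (\<lambda>(I :: ('c, 's, 'd, 'p) transit_instance, d). real (card (arcs (dgraph (constructed_diagram I d)))))
           \<in> O[principal asymptotic_domain](\<lambda>(I, d). real (n_to I d) * real (v_cap I) * real_of_int (T_w I)) \<and>
         (\<lambda>(I :: ('c, 's, 'd, 'p) transit_instance, d). real (running_time I d))
           \<in> O[principal asymptotic_domain](\<lambda>(I, d). real (card (passengers I)) * real (v_cap I) * real_of_int (T_w I))"
proof (intro conjI allI impI)
  fix I :: "('c, 's, 'd, 'p) transit_instance" and d :: 'd
  assume "valid_instance I \<and> d \<in> destinations I"
  then interpret transit_destination I d by unfold_locales auto
  show "layered_diagram (v_cap I) (n_to I d) (constructed_diagram I d)" by (rule layered)
  show "is_decision_diagram (v_cap I) (n_to I d) (constructed_diagram I d)"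
    if "\<forall>j \<in> passengers_to I d. earliest_dep I j \<le> latest_dep I j"
    using that by (rule decision_diagram)
  show "DD1 I d (constructed_diagram I d)" by (rule DD1)
  show "DD2 I d (constructed_diagram I d)" by (rule DD2)
  show "DD3 I d (constructed_diagram I d)" by (rule DD3)
next
  have dom: "transit_destination I d \<and> 1 \<le> n_to I d \<and> 1 \<le> T_w I"
    if "(I, d) \<in> asymptotic_domain" for I :: "('c, 's, 'd, 'p) transit_instance" and d
    using that by (simp add: asymptotic_domain_def transit_destination_def)
  \<comment> \<open>Eventually in a principal filter means everywhere on the set, so one constant
    valid on the whole set suffices.\<close>
  have bigoI_domain: "f \<in> O[principal A](g)" if "\<And>x. x \<in> A \<Longrightarrow> norm (f x) \<le> c * norm (g x)"
    for f g :: "('c, 's, 'd, 'p) transit_instance \<times> 'd \<Rightarrow> real" and c A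
    using that by (intro bigoI[of _ c]) (simp add: eventually_principal)
  show "(\<lambda>(I :: ('c, 's, 'd, 'p) transit_instance, d). real (card (verts (dgraph (constructed_diagram I d)))))
      \<in> O[principal asymptotic_domain](\<lambda>(I, d). real (n_to I d) * real (v_cap I))"
    using dom transit_destination.card_nodes_bound
    by (intro bigoI_domain[where c = 2]) (fastforce simp: abs_mult)
  show "(\<lambda>(I :: ('c, 's, 'd, 'p) transit_instance, d). real (card (arcs (dgraph (constructed_diagram I d)))))
      \<in> O[principal asymptotic_domain](\<lambda>(I, d). real (n_to I d) * real (v_cap I) * real_of_int (T_w I))"
  proof (rule bigoI_domain[where c = 20], clarify)
    fix I :: "('c, 's, 'd, 'p) transit_instance" and d
    assume "(I, d) \<in> asymptotic_domain"
    then interpret transit_destination I d using dom by blast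
    \<comment> \<open>The arcs are bounded through the running time, whose bound is stated in terms
      of \<open>n\<close> for this purpose.\<close>
    show "norm (real (card (arcs (dgraph D)))) \<le> 20 * norm (real n * real v * real_of_int (T_w I))"
      using card_arcs_le running_time_bound dom[OF \<open>(I, d) \<in> asymptotic_domain\<close>] by (simp add: abs_mult)
  qed
  show "(\<lambda>(I :: ('c, 's, 'd, 'p) transit_instance, d). real (running_time I d))
      \<in> O[principal asymptotic_domain](\<lambda>(I, d). real (card (passengers I)) * real (v_cap I) * real_of_int (T_w I))"
  proof (rule bigoI_domain[where c = 20], clarify)
    fix I :: "('c, 's, 'd, 'p) transit_instance" and d
    assume *: "(I, d) \<in> asymptotic_domain"
    then interpret transit_destination I d using dom by blast
    \<comment> \<open>Only here is the number of passengers to \<open>d\<close> replaced by the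
      number of all passengers.\<close>
    have "real n * real v * real_of_int (T_w I) \<le> real (card (passengers I)) * real v * real_of_int (T_w I)"
      using n_le dom[OF *] by (intro mult_right_mono) auto
    then show "norm (real (running_time I d)) \<le> 20 * norm (real (card (passengers I)) * real v * real_of_int (T_w I))"
      using running_time_bound dom[OF *] by (simp add: abs_mult)
  qed
qed

end
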